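(* Let $\pi=\sum_{k=1}^m w_k\pi_k$ be a mixture of probability distributions $\pi_k$ on a state space $\Omega$, with $w_k>0$, $\sum_kw_k=1$, and let $P(y\mid x)$ be a proposal kernel on $\Omega$. Let $Q$ be the transition kernel of the Metropolis–Hastings chain with proposal $P$ and stationary distribution $\pi$, and $\mathscr{L}=Q-I$; for each $k$ let $Q_k$ be the transition kernel of the Metropolis–Hastings chain with the same proposal $P$ and stationary distribution $\pi_k$, and $\mathscr{L}_k=Q_k-I$. Then for all $f$, $$\langle f,\mathscr{L}f\rangle_\pi\le\sum_{k=1}^m w_k\langle f,\mathscr{L}_kf\rangle_{\pi_k}.$$
   Context: $\pi(x)$, $\pi_k(x)$ and $P(y\mid x)$ denote densities with respect to a fixed reference measure on $\Omega$ (counting measure if $\Omega$ is discrete). The Metropolis–Hastings chain with proposal $P$ and stationary distribution $\pi$: from $x$, propose $y$ according to $P(\cdot\mid x)$ and accept it with probability $\alpha(x,y)=\min\left(1,\frac{\pi(y)P(x\mid y)}{\pi(x)P(y\mid x)}\right)$, otherwise stay at $x$; thus $Q(y\mid x)=P(y\mid x)\alpha(x,y)$ for $y\ne x$. $\langle f,g\rangle_\pi=\int fg\,d\pi$; $f$ ranges over real functions in $L^2(\pi)$. *)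

theory Defs
  imports "HOL-Probability.Probability"
begin

text \<open>Throughout, \<open>M\<close> is the reference measure on the state space, and \<open>P x y\<close> stands for
  \<open>P(y | x)\<close>: the first argument is the current state.\<close>

definition prob_density_on :: "'a measure \<Rightarrow> ('a \<Rightarrow> real) \<Rightarrow> bool" where
  "prob_density_on M p \<longleftrightarrow>
     p \<in> borel_measurable M \<and> (\<forall>x\<in>space M. 0 \<le> p x) \<and> (\<integral>\<^sup>+x. ennreal (p x) \<partial>M) = 1"

definition density_kernel :: "'a measure \<Rightarrow> ('a \<Rightarrow> 'a \<Rightarrow> real) \<Rightarrow> bool" where
  "density_kernel M P \<longleftrightarrow>
     (\<lambda>(x, y). P x y) \<in> borel_measurable (M \<Otimes>\<^sub>M M) \<and> (\<forall>x\<in>space M. prob_density_on M (P x))"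

abbreviation distribution_of :: "'a measure \<Rightarrow> ('a \<Rightarrow> real) \<Rightarrow> 'a measure" where
  "distribution_of M p \<equiv> density M (\<lambda>x. ennreal (p x))"

text \<open>The ratio is undefined when its denominator vanishes; the usual convention is that such a
  proposal is accepted (plain division by zero would give acceptance probability \<open>0\<close>).\<close>

definition mh_accept :: "('a \<Rightarrow> 'a \<Rightarrow> real) \<Rightarrow> ('a \<Rightarrow> real) \<Rightarrow> 'a \<Rightarrow> 'a \<Rightarrow> real" where
  "mh_accept P p x y =
     (if p x * P x y = 0 then 1 else min 1 ((p y * P y x) / (p x * P x y)))"

definition mh_kernel ::
    "'a measure \<Rightarrow> ('a \<Rightarrow> 'a \<Rightarrow> real) \<Rightarrow> ('a \<Rightarrow> real) \<Rightarrow> 'a \<Rightarrow> 'a measure" where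
  "mh_kernel M P p x =
     distribution_of M (P x) \<bind>
       (\<lambda>y. distr (measure_pmf (bernoulli_pmf (mh_accept P p x y))) M
              (\<lambda>accepted. if accepted then y else x))"

definition kernel_generator :: "('a \<Rightarrow> 'a measure) \<Rightarrow> ('a \<Rightarrow> real) \<Rightarrow> 'a \<Rightarrow> real" where
  "kernel_generator Q f x = (\<integral>y. f y \<partial>Q x) - f x"

definition inner_L2 :: "'a measure \<Rightarrow> ('a \<Rightarrow> real) \<Rightarrow> ('a \<Rightarrow> real) \<Rightarrow> real" where
  "inner_L2 N f g = (\<integral>x. f x * g x \<partial>N)"

definition in_L2 :: "'a measure \<Rightarrow> ('a \<Rightarrow> real) \<Rightarrow> bool" where
  "in_L2 N f \<longleftrightarrow> f \<in> borel_measurable N \<and> integrable N (\<lambda>x. (f x)\<^sup>2)"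

lemma mh_accept_bounds:
  assumes "\<And>x. x \<in> space M \<Longrightarrow> 0 \<le> p x" "\<And>x y. x \<in> space M \<Longrightarrow> y \<in> space M \<Longrightarrow> 0 \<le> P x y"
    and "x \<in> space M" "y \<in> space M"
  shows "0 \<le> mh_accept P p x y" "mh_accept P p x y \<le> 1"
  using assms by (auto simp: mh_accept_def)

lemma mh_accept_measurable:
  assumes "density_kernel M P" "p \<in> borel_measurable M" "x \<in> space M"
  shows "mh_accept P p x \<in> borel_measurable M"
proof -
  have PP: "(\<lambda>(x, y). P x y) \<in> borel_measurable (M \<Otimes>\<^sub>M M)"
    using assms(1) by (simp add: density_kernel_def)
  have [measurable]: "P x \<in> borel_measurable M"
    using measurable_compose[OF measurable_Pair1'[OF assms(3)] PP] by simp
  have [measurable]: "(\<lambda>y. P y x) \<in> borel_measurable M"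
    using measurable_compose[OF measurable_Pair2'[OF assms(3)] PP] by simp
  note [measurable] = assms(2)
  show ?thesis
    unfolding mh_accept_def by measurable
qed

lemma mh_kernel_accept_step:
  assumes "x \<in> space M" "y \<in> space M" "A \<in> sets M" "0 \<le> a" "a \<le> 1"
  shows "emeasure (distr (measure_pmf (bernoulli_pmf a)) M (\<lambda>b. if b then y else x)) A
           = ennreal a * indicator A y + ennreal (1 - a) * indicator A x"
proof -
  have m: "(\<lambda>b. if b then y else x) \<in> measurable (measure_pmf (bernoulli_pmf a)) M"
    using assms by auto
  have "emeasure (distr (measure_pmf (bernoulli_pmf a)) M (\<lambda>b. if b then y else x)) A
      = (\<integral>\<^sup>+b. indicator A (if b then y else x) \<partial>measure_pmf (bernoulli_pmf a))"
    using m assms(3)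
    by (subst nn_integral_indicator[symmetric], simp, subst nn_integral_distr) auto
  also have "\<dots> = ennreal a * indicator A y + ennreal (1 - a) * indicator A x"
    using assms(4,5) by (subst nn_integral_bernoulli_pmf) (auto simp: mult.commute)
  finally show ?thesis .
qed

text \<open>The kernel defined by the propose/accept mechanism has density \<open>P(y | x) \<alpha>(x, y)\<close>
  away from \<open>x\<close>, and the rejection probability as additional mass at \<open>x\<close>.\<close>

lemma mh_kernel_props:
  assumes K: "density_kernel M P" and p: "prob_density_on M p" and x: "x \<in> space M"
  shows sets_mh_kernel: "sets (mh_kernel M P p x) = sets M"
    and prob_space_mh_kernel: "prob_space (mh_kernel M P p x)"
    and emeasure_mh_kernel: "A \<in> sets M \<Longrightarrow> emeasure (mh_kernel M P p x) A =
        (\<integral>\<^sup>+y. ennreal (P x y * mh_accept P p x y) * indicator A y \<partial>M)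
        + (\<integral>\<^sup>+y. ennreal (P x y * (1 - mh_accept P p x y)) \<partial>M) * indicator A x"
proof -
  define N where "N = distribution_of M (P x)"
  define F where "F = (\<lambda>y. distr (measure_pmf (bernoulli_pmf (mh_accept P p x y))) M
              (\<lambda>b. if b then y else x))"
  have Q: "mh_kernel M P p x = N \<bind> F"
    by (simp add: mh_kernel_def N_def F_def)
  have nn: "\<And>x. x \<in> space M \<Longrightarrow> 0 \<le> p x" "\<And>x y. x \<in> space M \<Longrightarrow> y \<in> space M \<Longrightarrow> 0 \<le> P x y"
    using K p by (auto simp: density_kernel_def prob_density_on_def)
  have b: "0 \<le> mh_accept P p x y" "mh_accept P p x y \<le> 1" if "y \<in> space M" for y
    using mh_accept_bounds[of M p P x y] nn x that by auto
  have [measurable]: "P x \<in> borel_measurable M"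
    using K x by (auto simp: density_kernel_def prob_density_on_def)
  have [measurable]: "mh_accept P p x \<in> borel_measurable M"
    using mh_accept_measurable[OF K _ x] p by (auto simp: prob_density_on_def)
  have F1: "emeasure (F y) A = ennreal (mh_accept P p x y) * indicator A y
      + ennreal (1 - mh_accept P p x y) * indicator A x"
    if "y \<in> space M" "A \<in> sets M" for y A
    unfolding F_def by (rule mh_kernel_accept_step[OF x that b[OF that(1)]])
  have FP: "prob_space (F y)" if "y \<in> space M" for y
    unfolding F_def by (rule measure_pmf.prob_space_distr) (use x that in simp)
  have N1: "prob_space N"
  proof (rule prob_spaceI)
    have "emeasure N (space N) = (\<integral>\<^sup>+y. ennreal (P x y) * indicator (space M) y \<partial>M)"
      unfolding N_def by (simp add: emeasure_density)
    also have "\<dots> = (\<integral>\<^sup>+y. ennreal (P x y) \<partial>M)"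
      by (rule nn_integral_cong) simp
    also have "\<dots> = 1"
      using K x by (simp add: density_kernel_def prob_density_on_def)
    finally show "emeasure N (space N) = 1" .
  qed
  have spN: "space N = space M" "sets N = sets M" by (auto simp: N_def)
  have FM: "F \<in> measurable N (prob_algebra M)"
  proof (rule measurable_prob_algebraI)
    show "prob_space (F y)" if "y \<in> space N" for y using that FP spN by auto
    show "F \<in> measurable N (subprob_algebra M)"
    proof (rule measurable_subprob_algebra)
      show "subprob_space (F y)" if "y \<in> space N" for y
        using FP that spN by (auto intro: prob_space_imp_subprob_space)
      show "sets (F y) = sets M" for y by (simp add: F_def)
      fix A assume A[measurable]: "A \<in> sets M"
      have "(\<lambda>y. ennreal (mh_accept P p x y) * indicator A y
          + ennreal (1 - mh_accept P p x y) * indicator A x) \<in> borel_measurable M"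
        by measurable
      then show "(\<lambda>y. emeasure (F y) A) \<in> borel_measurable N"
        using F1 A spN by (subst measurable_cong[OF F1]) (auto simp: N_def)
    qed
  qed
  note FS = measurable_prob_algebraD[OF FM]
  have ne: "space N \<noteq> {}" using x spN by auto
  show "sets (mh_kernel M P p x) = sets M"
    unfolding Q by (rule sets_bind[OF sets_kernel[OF FS] ne])
  show "prob_space (mh_kernel M P p x)"
    unfolding Q
    by (rule prob_space.prob_space_bind[OF N1 _ FS]) (use FP spN in auto)
  assume A[measurable]: "A \<in> sets M"
  have "emeasure (mh_kernel M P p x) A = (\<integral>\<^sup>+y. emeasure (F y) A \<partial>N)"
    unfolding Q by (rule emeasure_bind[OF ne FS A])
  also have "\<dots> = (\<integral>\<^sup>+y. (ennreal (mh_accept P p x y) * indicator A y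
      + ennreal (1 - mh_accept P p x y) * indicator A x) \<partial>N)"
    using F1 A spN by (intro nn_integral_cong) auto
  also have "\<dots> = (\<integral>\<^sup>+y. ennreal (P x y) * (ennreal (mh_accept P p x y) * indicator A y
      + ennreal (1 - mh_accept P p x y) * indicator A x) \<partial>M)"
    unfolding N_def by (subst nn_integral_density) auto
  also have "\<dots> = (\<integral>\<^sup>+y. ennreal (P x y * mh_accept P p x y) * indicator A y
      + ennreal (P x y * (1 - mh_accept P p x y)) * indicator A x \<partial>M)"
    using nn x b by (intro nn_integral_cong) (auto simp: ennreal_mult distrib_left mult.assoc)
  also have "\<dots> = (\<integral>\<^sup>+y. ennreal (P x y * mh_accept P p x y) * indicator A y \<partial>M)
      + (\<integral>\<^sup>+y. ennreal (P x y * (1 - mh_accept P p x y)) * indicator A x \<partial>M)"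
    by (rule nn_integral_add) auto
  also have "(\<integral>\<^sup>+y. ennreal (P x y * (1 - mh_accept P p x y)) * indicator A x \<partial>M)
      = (\<integral>\<^sup>+y. ennreal (P x y * (1 - mh_accept P p x y)) \<partial>M) * indicator A x"
    by (rule nn_integral_multc) auto
  finally show "emeasure (mh_kernel M P p x) A =
        (\<integral>\<^sup>+y. ennreal (P x y * mh_accept P p x y) * indicator A y \<partial>M)
        + (\<integral>\<^sup>+y. ennreal (P x y * (1 - mh_accept P p x y)) \<partial>M) * indicator A x" .
qed

end

theory Submission
  imports Defs
begin

text \<open>Whatever the target density \<open>p\<close>, the product \<open>p(x) P(y | x) \<alpha>(x, y)\<close> is the symmetric flow
  \<open>s\<^sub>p(x, y) = min (p(x) P(y | x)) (p(y) P(x | y))\<close>. Hence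
  \<open>\<langle>f, \<L> f\<rangle> = - 1/2 \<integral>\<integral> s\<^sub>p(x, y) (f(y) - f(x))\<^sup>2\<close>, and since the minimum of two
  linear functions of \<open>p\<close> is superadditive and positively homogeneous, the flow of a mixture
  dominates the mixture of the flows.\<close>

section \<open>The symmetric flow and mixtures of densities\<close>

definition mh_flow :: "('a \<Rightarrow> 'a \<Rightarrow> real) \<Rightarrow> ('a \<Rightarrow> real) \<Rightarrow> 'a \<Rightarrow> 'a \<Rightarrow> real" where
  "mh_flow P p x y = min (p x * P x y) (p y * P y x)"

lemma mh_flow_commute: "mh_flow P p x y = mh_flow P p y x"
  by (simp add: mh_flow_def min.commute)

text \<open>A component flow is at most each of the two products whose minimum it is. Summing with
  nonnegative weights bounds the left side by both products for the mixture, hence by their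
  minimum.\<close>

lemma mh_flow_mixture:
  assumes "\<And>k. k \<in> I \<Longrightarrow> 0 \<le> w k"
    and "p x = (\<Sum>k\<in>I. w k * q k x)" "p y = (\<Sum>k\<in>I. w k * q k y)"
  shows "(\<Sum>k\<in>I. w k * mh_flow P (q k) x y) \<le> mh_flow P p x y"
proof -
  have "(\<Sum>k\<in>I. w k * mh_flow P (q k) x y) \<le> (\<Sum>k\<in>I. w k * (q k x * P x y))"
    "(\<Sum>k\<in>I. w k * mh_flow P (q k) x y) \<le> (\<Sum>k\<in>I. w k * (q k y * P y x))"
    using assms(1) by (auto simp: mh_flow_def intro!: sum_mono mult_left_mono)
  then show ?thesis
    using assms(2,3) by (simp add: mh_flow_def sum_distrib_right mult.assoc)
qed

lemma prob_density_on_mixture: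
  assumes "\<And>k. k \<in> I \<Longrightarrow> prob_density_on M (q k)"
    and "\<And>k. k \<in> I \<Longrightarrow> 0 \<le> w k" "(\<Sum>k\<in>I. w k) = 1"
    and p: "\<And>x. x \<in> space M \<Longrightarrow> p x = (\<Sum>k\<in>I. w k * q k x)"
  shows "prob_density_on M p"
  unfolding prob_density_on_def
proof (intro conjI ballI)
  have [measurable]: "q k \<in> borel_measurable M" if "k \<in> I" for k
    using assms(1)[OF that] by (simp add: prob_density_on_def)
  have nn: "0 \<le> q k x" if "k \<in> I" "x \<in> space M" for k x
    using assms(1)[OF that(1)] that(2) by (simp add: prob_density_on_def)
  show "p \<in> borel_measurable M"
    by (subst measurable_cong[OF p]) auto
  show "0 \<le> p x" if "x \<in> space M" for x
    using that nn assms(2) by (auto simp: p intro!: sum_nonneg)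
  have "(\<integral>\<^sup>+x. ennreal (p x) \<partial>M) = (\<integral>\<^sup>+x. (\<Sum>k\<in>I. ennreal (w k) * ennreal (q k x)) \<partial>M)"
    using nn assms(2) by (intro nn_integral_cong) (auto simp: p sum_ennreal ennreal_mult[symmetric])
  also have "\<dots> = (\<Sum>k\<in>I. ennreal (w k) * (\<integral>\<^sup>+x. ennreal (q k x) \<partial>M))"
    by (subst nn_integral_sum) (auto intro!: sum.cong nn_integral_cmult)
  also have "\<dots> = (\<Sum>k\<in>I. ennreal (w k))"
    using assms(1) by (intro sum.cong) (auto simp: prob_density_on_def)
  also have "\<dots> = 1"
    using assms(2,3) by (simp add: sum_ennreal)
  finally show "(\<integral>\<^sup>+x. ennreal (p x) \<partial>M) = 1" .
qed

text \<open>Serves to pass from the mixture to a component: there \<open>c\<close> is the weight of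
  the component, and \<open>p x * (f x)^2 / c\<close> dominates
  \<open>q x * (f x)^2\<close>.\<close>

lemma in_L2_density_mono:
  assumes "in_L2 (distribution_of M p) f" "p \<in> borel_measurable M" "q \<in> borel_measurable M"
    and "\<And>x. x \<in> space M \<Longrightarrow> 0 \<le> q x" "\<And>x. x \<in> space M \<Longrightarrow> c * q x \<le> p x" "0 < c"
  shows "in_L2 (distribution_of M q) f"
proof -
  have f[measurable]: "f \<in> borel_measurable M"
    using assms(1) by (simp add: in_L2_def)
  note [measurable] = assms(2,3)
  have nnp: "0 \<le> p x" if "x \<in> space M" for x
    using assms(4,5)[OF that] \<open>0 < c\<close> by (meson mult_nonneg_nonneg order.trans less_imp_le)
  have "integrable M (\<lambda>x. p x * (f x)\<^sup>2)"
    using assms(1) nnp by (simp add: in_L2_def integrable_density)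
  then have "integrable M (\<lambda>x. p x * (f x)\<^sup>2 / c)"
    by simp
  then have "integrable M (\<lambda>x. q x * (f x)\<^sup>2)"
  proof (rule Bochner_Integration.integrable_bound)
    have "q x * (f x)\<^sup>2 \<le> p x * (f x)\<^sup>2 / c" if "x \<in> space M" for x
      using mult_right_mono[OF assms(5)[OF that], of "(f x)\<^sup>2"] \<open>0 < c\<close> by (simp add: field_simps)
    then show "AE x in M. norm (q x * (f x)\<^sup>2) \<le> norm (p x * (f x)\<^sup>2 / c)"
      using assms(4) nnp \<open>0 < c\<close> by (intro AE_I2) simp
  qed auto
  then show ?thesis
    using assms(4) by (simp add: in_L2_def integrable_density)
qed

section \<open>The chain with a single target density\<close>

locale metropolis_hastings = pair_sigma_finite M M
  for M :: "'a measure" +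
  fixes P :: "'a \<Rightarrow> 'a \<Rightarrow> real" and p :: "'a \<Rightarrow> real"
  assumes density_kernel: "density_kernel M P" and prob_density: "prob_density_on M p"
begin

lemma proposal_nonneg: "x \<in> space M \<Longrightarrow> y \<in> space M \<Longrightarrow> 0 \<le> P x y"
  using density_kernel by (auto simp: density_kernel_def prob_density_on_def)

lemma target_nonneg: "x \<in> space M \<Longrightarrow> 0 \<le> p x"
  using prob_density by (auto simp: prob_density_on_def)

lemma target_measurable[measurable]: "p \<in> borel_measurable M"
  using prob_density by (auto simp: prob_density_on_def)

text \<open>The form with composed arguments covers \<open>P x y\<close> and \<open>P y x\<close>
  alike, with one coordinate fixed or with both varying.\<close>

lemma proposal_measurable[measurable (raw)]:
  assumes [measurable]: "g \<in> measurable N M" "h \<in> measurable N M"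
  shows "(\<lambda>z. P (g z) (h z)) \<in> borel_measurable N"
proof -
  have "(\<lambda>(x, y). P x y) \<in> borel_measurable (M \<Otimes>\<^sub>M M)"
    using density_kernel by (simp add: density_kernel_def)
  from measurable_compose[OF measurable_Pair[OF assms] this] show ?thesis
    by simp
qed

lemma accept_measurable[measurable (raw)]:
  assumes [measurable]: "g \<in> measurable N M" "h \<in> measurable N M"
  shows "(\<lambda>z. mh_accept P p (g z) (h z)) \<in> borel_measurable N"
  unfolding mh_accept_def by measurable

lemma flow_measurable[measurable (raw)]:
  assumes [measurable]: "g \<in> measurable N M" "h \<in> measurable N M"
  shows "(\<lambda>z. mh_flow P p (g z) (h z)) \<in> borel_measurable N"
  unfolding mh_flow_def by measurable

lemma accept_bounds:
  assumes "x \<in> space M" "y \<in> space M"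
  shows "0 \<le> mh_accept P p x y" "mh_accept P p x y \<le> 1"
  using mh_accept_bounds[of M p P x y] assms target_nonneg proposal_nonneg by auto

lemma flow_nonneg: "x \<in> space M \<Longrightarrow> y \<in> space M \<Longrightarrow> 0 \<le> mh_flow P p x y"
  by (simp add: mh_flow_def target_nonneg proposal_nonneg)

text \<open>For \<open>a > 0\<close>, multiplying \<open>min 1 (b / a)\<close> by \<open>a\<close>
  gives \<open>min a b\<close>; here \<open>a\<close> is \<open>p x * P x y\<close> and
  \<open>b\<close> is \<open>p y * P y x\<close>.\<close>

lemma flow_eq_accept:
  assumes "x \<in> space M" "y \<in> space M"
  shows "mh_flow P p x y = p x * (P x y * mh_accept P p x y)"
proof (cases "p x * P x y = 0")
  \<comment> \<open>Both sides are zero: the flow because the reverse product is nonnegative, the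
    right side because of its factor \<open>p x * P x y\<close>.\<close>
  case True
  then show ?thesis
    using assms target_nonneg proposal_nonneg by (auto simp: mh_flow_def min_def)
next
  case False
  moreover have "0 \<le> p x * P x y"
    using assms target_nonneg proposal_nonneg by simp
  ultimately have "0 < p x * P x y"
    by linarith
  then show ?thesis
    by (auto simp: mh_flow_def mh_accept_def min_def field_simps)
qed

section \<open>Integration against the transition kernel\<close>

text \<open>Extends the formula for the mass of a set, a density part plus an atom at
  \<open>x\<close>, from indicators to nonnegative functions by monotone class induction.\<close>

lemma nn_integral_mh_kernel:
  assumes x: "x \<in> space M" and g: "g \<in> borel_measurable M"
  shows "(\<integral>\<^sup>+y. g y \<partial>mh_kernel M P p x) = (\<integral>\<^sup>+y. ennreal (P x y * mh_accept P p x y) * g y \<partial>M)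
    + (\<integral>\<^sup>+y. ennreal (P x y * (1 - mh_accept P p x y)) \<partial>M) * g x"
proof -
  note [measurable] = x
  note S = sets_mh_kernel[OF density_kernel prob_density x]
  note [measurable_cong] = S
  have sp: "space (mh_kernel M P p x) = space M"
    by (rule sets_eq_imp_space_eq[OF S])
  show ?thesis
    using g
  proof (induction rule: borel_measurable_induct)
    case (cong f g)
    then show ?case
      using x sp by (simp cong: nn_integral_cong_simp)
  next
    case (set A)
    then show ?case
      using emeasure_mh_kernel[OF density_kernel prob_density x set] S by simp
  next
    case (mult u c)
    then show ?case
      by (simp add: nn_integral_cmult distrib_left mult.left_commute)
  next
    case (add u v)
    then show ?case
      by (simp add: nn_integral_add distrib_left add_ac)
  next
    case (seq U)
    define a where "a = (\<lambda>y. ennreal (P x y * mh_accept P p x y))"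
    define r where "r = (\<integral>\<^sup>+y. ennreal (P x y * (1 - mh_accept P p x y)) \<partial>M)"
    have [measurable]: "a \<in> borel_measurable M"
      unfolding a_def by measurable
    have [measurable]: "U i \<in> borel_measurable M" for i
      using seq by simp
    have "(\<integral>\<^sup>+y. (SUP i. U i) y \<partial>mh_kernel M P p x)
        = (SUP i. \<integral>\<^sup>+y. U i y \<partial>mh_kernel M P p x)"
      unfolding SUP_apply by (rule nn_integral_monotone_convergence_SUP[OF seq(3)]) simp
    also have "\<dots> = (SUP i. (\<integral>\<^sup>+y. a y * U i y \<partial>M) + r * U i x)"
      using seq by (simp add: a_def r_def)
    \<comment> \<open>The supremum splits over the sum because both summands increase with
      \<open>i\<close>.\<close>
    also have "\<dots> = (SUP i. \<integral>\<^sup>+y. a y * U i y \<partial>M) + (SUP i. r * U i x)"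
      using seq(3) by (intro ennreal_SUP_add)
        (auto simp: incseq_def le_fun_def intro!: nn_integral_mono mult_left_mono)
    also have "(SUP i. \<integral>\<^sup>+y. a y * U i y \<partial>M) = (\<integral>\<^sup>+y. (SUP i. a y * U i y) \<partial>M)"
      using seq(3) by (intro nn_integral_monotone_convergence_SUP[symmetric])
        (auto simp: incseq_def le_fun_def intro!: mult_left_mono)
    finally show ?case
      by (simp add: a_def r_def SUP_mult_left_ennreal image_comp)
  qed
qed

text \<open>A function vanishing at \<open>x\<close> does not see the atom there, so the kernel
  integrates it like the measure with density \<open>P x y * mh_accept P p x y\<close>.\<close>

lemma integral_mh_kernel:
  fixes g :: "'a \<Rightarrow> real"
  assumes x: "x \<in> space M" and g[measurable]: "g \<in> borel_measurable M" and 0: "g x = 0"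
  shows "(\<integral>y. g y \<partial>mh_kernel M P p x) = (\<integral>y. P x y * mh_accept P p x y * g y \<partial>M)"
proof -
  note [measurable] = x
  note S = sets_mh_kernel[OF density_kernel prob_density x]
  note [measurable_cong] = S
  define a where "a = (\<lambda>y. P x y * mh_accept P p x y)"
  have [measurable]: "a \<in> borel_measurable M"
    unfolding a_def by measurable
  have a0: "0 \<le> a y" if "y \<in> space M" for y
    using that x proposal_nonneg accept_bounds by (simp add: a_def)
  \<comment> \<open>Applied below to the absolute value of \<open>g\<close>, which decides
    integrability, and to \<open>g\<close> and \<open>-g\<close>, whose truncations by
    \<open>ennreal\<close> are the positive and negative parts.\<close>
  have eq: "(\<integral>\<^sup>+y. ennreal (h y) \<partial>mh_kernel M P p x) = (\<integral>\<^sup>+y. ennreal (h y) \<partial>density M a)"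
    if [measurable]: "h \<in> borel_measurable M" and "h x = 0" for h
    using that(2) by (simp add: nn_integral_mh_kernel[OF x] nn_integral_density a_def)
  have "integrable (mh_kernel M P p x) g \<longleftrightarrow> integrable (density M a) g"
    using 0 by (simp add: integrable_iff_bounded eq)
  moreover have "(\<integral>y. g y \<partial>mh_kernel M P p x) = (\<integral>y. g y \<partial>density M a)"
    if "integrable (mh_kernel M P p x) g" "integrable (density M a) g"
    using that 0 by (simp add: real_lebesgue_integral_def eq)
  \<comment> \<open>If \<open>g\<close> is integrable for neither measure, both integrals have the
    default value 0.\<close>
  ultimately have "(\<integral>y. g y \<partial>mh_kernel M P p x) = (\<integral>y. g y \<partial>density M a)"
    using not_integrable_integral_eq by metis
  also have "\<dots> = (\<integral>y. a y * g y \<partial>M)"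
    using a0 by (subst integral_density) auto
  finally show ?thesis
    by (simp add: a_def)
qed

text \<open>Needed so that the generator applied to \<open>f\<close> is a measurable function; the
  explicit formula for the mass of a set is measurable in \<open>x\<close>.\<close>

lemma mh_kernel_measurable: "mh_kernel M P p \<in> measurable M (subprob_algebra M)"
proof (rule measurable_subprob_algebra)
  show "subprob_space (mh_kernel M P p x)" "sets (mh_kernel M P p x) = sets M"
    if "x \<in> space M" for x
    using prob_space_mh_kernel[OF density_kernel prob_density that]
      sets_mh_kernel[OF density_kernel prob_density that]
    by (auto intro: prob_space_imp_subprob_space)
  show "(\<lambda>x. emeasure (mh_kernel M P p x) A) \<in> borel_measurable M" if [measurable]: "A \<in> sets M" for A
    by (subst measurable_cong[OF emeasure_mh_kernel[OF density_kernel prob_density _ that]]) auto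
qed

section \<open>Integrability of the flow against squares and products of \<open>f\<close>\<close>

context
  fixes f :: "'a \<Rightarrow> real"
  assumes L2: "in_L2 (distribution_of M p) f"
begin

lemma L2_measurable[measurable]: "f \<in> borel_measurable M"
  using L2 by (simp add: in_L2_def)

text \<open>The flow is at most \<open>p x * P x y\<close>, and \<open>P x\<close> has total mass 1,
  so by Tonelli the integral is at most the squared norm of \<open>f\<close> in \<open>L^2\<close>
  of the target.\<close>

lemma integrable_flow_square_fst:
  "integrable (M \<Otimes>\<^sub>M M) (\<lambda>(x, y). mh_flow P p x y * (f x)\<^sup>2)"
proof (rule integrableI_bounded)
  have "(\<integral>\<^sup>+z. ennreal (norm (case z of (x, y) \<Rightarrow> mh_flow P p x y * (f x)\<^sup>2)) \<partial>(M \<Otimes>\<^sub>M M))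
      = (\<integral>\<^sup>+x. (\<integral>\<^sup>+y. ennreal (mh_flow P p x y * (f x)\<^sup>2) \<partial>M) \<partial>M)"
    by (subst M1.nn_integral_fst[symmetric]) (auto intro!: nn_integral_cong simp: flow_nonneg)
  also have "\<dots> \<le> (\<integral>\<^sup>+x. ennreal (p x * (f x)\<^sup>2) \<partial>M)"
  proof (rule nn_integral_mono)
    fix x assume x: "x \<in> space M"
    note [measurable] = x
    have "(\<integral>\<^sup>+y. ennreal (mh_flow P p x y * (f x)\<^sup>2) \<partial>M)
        \<le> (\<integral>\<^sup>+y. ennreal (p x * (f x)\<^sup>2) * ennreal (P x y) \<partial>M)"
    proof (rule nn_integral_mono)
      fix y assume "y \<in> space M"
      then have "mh_flow P p x y * (f x)\<^sup>2 \<le> p x * P x y * (f x)\<^sup>2"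
        by (intro mult_right_mono) (auto simp: mh_flow_def)
      then show "ennreal (mh_flow P p x y * (f x)\<^sup>2) \<le> ennreal (p x * (f x)\<^sup>2) * ennreal (P x y)"
        using x \<open>y \<in> space M\<close>
        by (simp add: ennreal_mult[symmetric] target_nonneg proposal_nonneg mult_ac ennreal_leI)
    qed
    also have "\<dots> = ennreal (p x * (f x)\<^sup>2)"
      using x density_kernel
      by (subst nn_integral_cmult) (auto simp: density_kernel_def prob_density_on_def)
    finally show "(\<integral>\<^sup>+y. ennreal (mh_flow P p x y * (f x)\<^sup>2) \<partial>M) \<le> ennreal (p x * (f x)\<^sup>2)" .
  qed
  also have "\<dots> = (\<integral>\<^sup>+x. ennreal (norm (p x * (f x)\<^sup>2)) \<partial>M)"
    by (intro nn_integral_cong) (simp add: target_nonneg)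
  also have "\<dots> < \<infinity>"
  proof -
    have "integrable M (\<lambda>x. p x * (f x)\<^sup>2)"
      using L2 target_nonneg by (simp add: in_L2_def integrable_density)
    then show ?thesis
      by (simp only: integrable_iff_bounded)
  qed
  finally show "(\<integral>\<^sup>+z. ennreal (norm (case z of (x, y) \<Rightarrow> mh_flow P p x y * (f x)\<^sup>2)) \<partial>(M \<Otimes>\<^sub>M M)) < \<infinity>" .
qed measurable

lemma integrable_flow_square_snd:
  "integrable (M \<Otimes>\<^sub>M M) (\<lambda>(x, y). mh_flow P p x y * (f y)\<^sup>2)"
  using integrable_product_swap[OF integrable_flow_square_fst]
  by (simp add: mh_flow_commute[of P p] case_prod_unfold)

text \<open>Dominated by the sum of the two preceding integrands, since
  \<open>\<bar>a * b\<bar> \<le> a^2 + b^2\<close>.\<close>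

lemma integrable_flow_product:
  "integrable (M \<Otimes>\<^sub>M M) (\<lambda>(x, y). mh_flow P p x y * (f x * f y))"
proof (rule Bochner_Integration.integrable_bound
    [OF Bochner_Integration.integrable_add[OF integrable_flow_square_fst integrable_flow_square_snd]])
  have "\<bar>mh_flow P p x y * (f x * f y)\<bar> \<le> mh_flow P p x y * (f x)\<^sup>2 + mh_flow P p x y * (f y)\<^sup>2"
    if "x \<in> space M" "y \<in> space M" for x y
  proof -
    have "\<bar>f x * f y\<bar> \<le> (f x)\<^sup>2 + (f y)\<^sup>2"
      using sum_squares_bound[of "\<bar>f x\<bar>" "\<bar>f y\<bar>"] abs_ge_zero[of "f x * f y"]
      unfolding abs_mult power2_abs by linarith
    from mult_left_mono[OF this flow_nonneg[OF that]] show ?thesis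
      by (simp add: abs_mult flow_nonneg that distrib_left)
  qed
  then show "AE z in M \<Otimes>\<^sub>M M. norm (case z of (x, y) \<Rightarrow> mh_flow P p x y * (f x * f y))
      \<le> norm ((case z of (x, y) \<Rightarrow> mh_flow P p x y * (f x)\<^sup>2)
          + (case z of (x, y) \<Rightarrow> mh_flow P p x y * (f y)\<^sup>2))"
    by (intro AE_I2) (fastforce simp: space_pair_measure intro: order.trans[OF _ abs_ge_self])
qed measurable

lemma integrable_flow_diff_square:
  "integrable (M \<Otimes>\<^sub>M M) (\<lambda>(x, y). mh_flow P p x y * (f y - f x)\<^sup>2)"
  using Bochner_Integration.integrable_diff
    [OF Bochner_Integration.integrable_add[OF integrable_flow_square_fst integrable_flow_square_snd]
      integrable_mult_right[OF integrable_flow_product, of 2]]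
  by (simp add: case_prod_unfold power2_diff algebra_simps)

section \<open>The quadratic form of the generator as a Dirichlet form\<close>

text \<open>The integrability assumption makes \<open>f\<close> integrable for the kernel when
  \<open>p x\<close> is nonzero, so \<open>f x\<close> can be moved under the integral. The
  difference \<open>f y - f x\<close> vanishes at \<open>y = x\<close>, which removes the
  atom.\<close>

lemma generator_eq_flow:
  assumes x: "x \<in> space M" and int: "integrable M (\<lambda>y. mh_flow P p x y * (f y)\<^sup>2)"
  shows "p x * (f x * kernel_generator (mh_kernel M P p) f x)
    = (\<integral>y. mh_flow P p x y * (f x * (f y - f x)) \<partial>M)"
proof (cases "p x = 0")
  case True
  then have "(\<integral>y. mh_flow P p x y * (f x * (f y - f x)) \<partial>M) = (\<integral>y. 0 \<partial>M)"
    using x by (intro Bochner_Integration.integral_cong) (auto simp: flow_eq_accept)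
  with True show ?thesis
    by simp
next
  case False
  note [measurable] = x
  note S = sets_mh_kernel[OF density_kernel prob_density x]
  note [measurable_cong] = S
  interpret Q: prob_space "mh_kernel M P p x"
    by (rule prob_space_mh_kernel[OF density_kernel prob_density x])
  \<comment> \<open>Dividing the flow by the nonzero \<open>p x\<close> leaves proposal density
    times acceptance probability.\<close>
  have "integrable M (\<lambda>y. mh_flow P p x y * (f y)\<^sup>2 / p x)"
    using int by simp
  also have "?this \<longleftrightarrow> integrable M (\<lambda>y. P x y * mh_accept P p x y * (f y)\<^sup>2)"
    using False x by (intro Bochner_Integration.integrable_cong) (auto simp: flow_eq_accept)
  finally have 1: "integrable M (\<lambda>y. P x y * mh_accept P p x y * (f y)\<^sup>2)" .
  have "(\<integral>\<^sup>+y. ennreal (P x y * (1 - mh_accept P p x y)) \<partial>M) \<le> (\<integral>\<^sup>+y. ennreal (P x y) \<partial>M)"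
    using x by (intro nn_integral_mono ennreal_leI) 
      (auto intro!: mult_left_le simp: accept_bounds proposal_nonneg)
  also have "\<dots> = 1"
    using x density_kernel by (simp add: density_kernel_def prob_density_on_def)
  finally have r: "(\<integral>\<^sup>+y. ennreal (P x y * (1 - mh_accept P p x y)) \<partial>M) \<le> 1" .
  have "(\<integral>\<^sup>+y. ennreal (P x y * mh_accept P p x y) * ennreal ((f y)\<^sup>2) \<partial>M)
      = (\<integral>\<^sup>+y. ennreal (norm (P x y * mh_accept P p x y * (f y)\<^sup>2)) \<partial>M)"
    using x by (intro nn_integral_cong)
      (auto simp: ennreal_mult[symmetric] proposal_nonneg accept_bounds abs_mult)
  also have "\<dots> < \<infinity>"
    using 1 by (simp add: integrable_iff_bounded)
  \<comment> \<open>The density part of the second moment is finite by the preceding bound; the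
    atom, of mass at most 1, adds at most \<open>(f x)^2\<close>.\<close>
  finally have "(\<integral>\<^sup>+y. ennreal ((f y)\<^sup>2) \<partial>mh_kernel M P p x) < \<infinity>"
    using r by (subst nn_integral_mh_kernel[OF x])
      (auto simp: ennreal_mult_less_top intro: order.strict_trans1)
  then have "integrable (mh_kernel M P p x) (\<lambda>y. (f y)\<^sup>2)"
    by (intro integrableI_bounded) auto
  then have fi: "integrable (mh_kernel M P p x) f"
    by (rule Q.square_integrable_imp_integrable[rotated]) simp
  then have "kernel_generator (mh_kernel M P p) f x = (\<integral>y. f y - f x \<partial>mh_kernel M P p x)"
    by (simp add: kernel_generator_def Q.prob_space)
  also have "\<dots> = (\<integral>y. P x y * mh_accept P p x y * (f y - f x) \<partial>M)"
    by (rule integral_mh_kernel[OF x]) auto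
  finally have "p x * (f x * kernel_generator (mh_kernel M P p) f x)
      = (\<integral>y. p x * f x * (P x y * mh_accept P p x y * (f y - f x)) \<partial>M)"
    by simp
  also have "\<dots> = (\<integral>y. mh_flow P p x y * (f x * (f y - f x)) \<partial>M)"
    using x by (intro Bochner_Integration.integral_cong) (auto simp: flow_eq_accept)
  finally show ?thesis .
qed

text \<open>The inner product is the double integral of \<open>?g\<close>; averaging it with its
  swap, by symmetry of the flow, produces the square and the factor 1/2.\<close>

theorem inner_generator_eq_dirichlet:
  "inner_L2 (distribution_of M p) f (kernel_generator (mh_kernel M P p) f)
    = - (1/2) * (\<integral>(x, y). mh_flow P p x y * (f y - f x)\<^sup>2 \<partial>(M \<Otimes>\<^sub>M M))"
proof -
  let ?g = "\<lambda>(x, y). mh_flow P p x y * (f x * (f y - f x))"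
  have gi: "integrable (M \<Otimes>\<^sub>M M) ?g"
    using Bochner_Integration.integrable_diff[OF integrable_flow_product integrable_flow_square_fst]
    by (simp add: case_prod_unfold power2_eq_square algebra_simps)
  have "(\<lambda>x. \<integral>y. f y \<partial>mh_kernel M P p x) \<in> borel_measurable M"
    by (rule measurable_compose[OF mh_kernel_measurable integral_measurable_subprob_algebra]) simp
  then have [measurable]: "kernel_generator (mh_kernel M P p) f \<in> borel_measurable M"
    unfolding kernel_generator_def by measurable
  have "inner_L2 (distribution_of M p) f (kernel_generator (mh_kernel M P p) f)
      = (\<integral>x. p x * (f x * kernel_generator (mh_kernel M P p) f x) \<partial>M)"
    unfolding inner_L2_def using target_nonneg by (subst integral_density) auto
  also have "\<dots> = (\<integral>x. (\<integral>y. mh_flow P p x y * (f x * (f y - f x)) \<partial>M) \<partial>M)"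
  proof (rule integral_cong_AE)
    \<comment> \<open>By Fubini the slices are integrable only for almost every \<open>x\<close>,
      hence the comparison of integrands almost everywhere.\<close>
    have "AE x in M. integrable M (\<lambda>y. mh_flow P p x y * (f y)\<^sup>2)"
      using AE_integrable_fst'[OF integrable_flow_square_snd] by simp
    then show "AE x in M. p x * (f x * kernel_generator (mh_kernel M P p) f x)
        = (\<integral>y. mh_flow P p x y * (f x * (f y - f x)) \<partial>M)"
      by (rule AE_mp) (auto intro!: AE_I2 generator_eq_flow)
  qed measurable
  also have "\<dots> = (\<integral>z. ?g z \<partial>(M \<Otimes>\<^sub>M M))"
    using integral_fst'[OF gi] by simp
  finally have 1: "inner_L2 (distribution_of M p) f (kernel_generator (mh_kernel M P p) f)
      = (\<integral>z. ?g z \<partial>(M \<Otimes>\<^sub>M M))" .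
  have "(\<integral>z. ?g z \<partial>(M \<Otimes>\<^sub>M M)) = (\<integral>(x, y). ?g (y, x) \<partial>(M \<Otimes>\<^sub>M M))"
    by (rule integral_product_swap[symmetric]) measurable
  then have "2 * (\<integral>z. ?g z \<partial>(M \<Otimes>\<^sub>M M))
      = (\<integral>z. ?g z \<partial>(M \<Otimes>\<^sub>M M)) + (\<integral>(x, y). ?g (y, x) \<partial>(M \<Otimes>\<^sub>M M))"
    by simp
  also have "\<dots> = (\<integral>z. ?g z + (case z of (x, y) \<Rightarrow> ?g (y, x)) \<partial>(M \<Otimes>\<^sub>M M))"
    by (rule Bochner_Integration.integral_add[symmetric, OF gi integrable_product_swap[OF gi]])
  also have "\<dots> = (\<integral>z. - (case z of (x, y) \<Rightarrow> mh_flow P p x y * (f y - f x)\<^sup>2) \<partial>(M \<Otimes>\<^sub>M M))"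
  proof (rule Bochner_Integration.integral_cong[OF refl], clarsimp)
    fix x y
    show "mh_flow P p x y * (f x * (f y - f x)) + mh_flow P p y x * (f y * (f x - f y))
        = - (mh_flow P p x y * (f y - f x)\<^sup>2)"
      unfolding mh_flow_commute[of P p y x] by (simp add: power2_eq_square algebra_simps)
  qed
  finally show ?thesis
    using 1 by simp
qed

end

end

section \<open>Comparison of the Dirichlet forms of the mixture and its components\<close>

theorem proposition8:
  fixes M :: "'a measure"
    and P :: "'a \<Rightarrow> 'a \<Rightarrow> real"
    and \<pi> :: "'a \<Rightarrow> real"
    and \<pi>k :: "nat \<Rightarrow> 'a \<Rightarrow> real"
    and w :: "nat \<Rightarrow> real"
    and m :: nat
    and f :: "'a \<Rightarrow> real"
  assumes "sigma_finite_measure M"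
    and "density_kernel M P"
    and "\<And>k. k \<in> {1..m} \<Longrightarrow> prob_density_on M (\<pi>k k)"
    and "\<And>k. k \<in> {1..m} \<Longrightarrow> w k > 0"
    and "(\<Sum>k=1..m. w k) = 1"
    and "\<And>x. x \<in> space M \<Longrightarrow> \<pi> x = (\<Sum>k=1..m. w k * \<pi>k k x)"
    and "in_L2 (distribution_of M \<pi>) f"
  shows "inner_L2 (distribution_of M \<pi>) f (kernel_generator (mh_kernel M P \<pi>) f)
       \<le> (\<Sum>k=1..m. w k * inner_L2 (distribution_of M (\<pi>k k)) f
                                    (kernel_generator (mh_kernel M P (\<pi>k k)) f))"
proof -
  interpret sigma_finite_measure M by fact
  interpret pair_sigma_finite M M ..
  have \<pi>: "prob_density_on M \<pi>"
    using assms(4) by (intro prob_density_on_mixture[OF assms(3) _ assms(5,6)]) (auto intro: less_imp_le)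
  interpret mix: metropolis_hastings M P \<pi>
    by unfold_locales (fact assms \<pi>)+
  have comp: "metropolis_hastings M P (\<pi>k k)" if "k \<in> {1..m}" for k
    by unfold_locales (use assms that in auto)
  have comp_nonneg: "0 \<le> \<pi>k k x" if "k \<in> {1..m}" "x \<in> space M" for k x
    using metropolis_hastings.target_nonneg[OF comp] that by simp
  \<comment> \<open>The mixture dominates each of its nonnegative summands
    \<open>w k * \<pi>k k x\<close>, so the constant is \<open>w k\<close>.\<close>
  have L2: "in_L2 (distribution_of M (\<pi>k k)) f" if k: "k \<in> {1..m}" for k
  proof (rule in_L2_density_mono[OF assms(7)])
    show "w k * \<pi>k k x \<le> \<pi> x" if "x \<in> space M" for x
      unfolding assms(6)[OF that]
      by (rule member_le_sum[OF k, where f = "\<lambda>k. w k * \<pi>k k x"])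
        (use assms(4) comp_nonneg that in \<open>auto simp: less_imp_le\<close>)
  qed (use k assms(4) comp_nonneg metropolis_hastings.target_measurable[OF comp] in auto)
  let ?e = "\<lambda>p (x, y). mh_flow P p x y * (f y - f x)\<^sup>2"
  have int: "integrable (M \<Otimes>\<^sub>M M) (?e (\<pi>k k))" if "k \<in> {1..m}" for k
    by (rule metropolis_hastings.integrable_flow_diff_square[OF comp L2]) (use that in auto)
  have "(\<Sum>k=1..m. w k * (\<integral>z. ?e (\<pi>k k) z \<partial>(M \<Otimes>\<^sub>M M)))
      = (\<integral>z. (\<Sum>k=1..m. w k * ?e (\<pi>k k) z) \<partial>(M \<Otimes>\<^sub>M M))"
    using int by (subst Bochner_Integration.integral_sum) auto
  also have "\<dots> \<le> (\<integral>z. ?e \<pi> z \<partial>(M \<Otimes>\<^sub>M M))"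
  proof (rule integral_mono)
    show "integrable (M \<Otimes>\<^sub>M M) (\<lambda>z. \<Sum>k=1..m. w k * ?e (\<pi>k k) z)"
      using int by auto
    show "integrable (M \<Otimes>\<^sub>M M) (?e \<pi>)"
      by (rule mix.integrable_flow_diff_square[OF assms(7)])
    fix z assume "z \<in> space (M \<Otimes>\<^sub>M M)"
    then obtain x y where z: "z = (x, y)" "x \<in> space M" "y \<in> space M"
      by (auto simp: space_pair_measure)
    have "(\<Sum>k=1..m. w k * mh_flow P (\<pi>k k) x y) \<le> mh_flow P \<pi> x y"
      using assms(4) by (intro mh_flow_mixture assms(6) z) (auto intro: less_imp_le)
    from mult_right_mono[OF this, of "(f y - f x)\<^sup>2"]
    show "(\<Sum>k=1..m. w k * ?e (\<pi>k k) z) \<le> ?e \<pi> z"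
      by (simp add: z sum_distrib_right mult.assoc)
  qed
  finally have le: "(\<Sum>k=1..m. w k * (\<integral>z. ?e (\<pi>k k) z \<partial>(M \<Otimes>\<^sub>M M)))
      \<le> (\<integral>z. ?e \<pi> z \<partial>(M \<Otimes>\<^sub>M M))" .
  have "(\<Sum>k=1..m. w k * inner_L2 (distribution_of M (\<pi>k k)) f
            (kernel_generator (mh_kernel M P (\<pi>k k)) f))
      = (\<Sum>k=1..m. - (1/2) * (w k * (\<integral>z. ?e (\<pi>k k) z \<partial>(M \<Otimes>\<^sub>M M))))"
    by (intro sum.cong refl)
      (simp add: metropolis_hastings.inner_generator_eq_dirichlet[OF comp L2])
  also have "\<dots> = - (1/2) * (\<Sum>k=1..m. w k * (\<integral>z. ?e (\<pi>k k) z \<partial>(M \<Otimes>\<^sub>M M)))"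
    by (rule sum_distrib_left[symmetric])
  \<comment> \<open>The factor -1/2 reverses the inequality between the Dirichlet integrals.\<close>
  finally show ?thesis
    using le mix.inner_generator_eq_dirichlet[OF assms(7)] by simp
qed

end
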